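(* Let $A\in\mathbb{R}^{m\times n}$ and let $R:\mathbb{R}^n\to\mathbb{R}\cup\{+\infty\}$ be a proper and lower semicontinuous function. Assume that $R$ is non-negative and that $\ker(R_\infty)\cap\ker(A)=\{0\}$. Then for any $\lambda>0$ and $y\in\mathbb{R}^m$, the problem $$\inf_{x\in\mathbb{R}^n}\ \|y-|Ax|^2\|^2+\lambda R(x)$$ has a non-empty compact set of minimizers.
   Context: $\|\cdot\|$ is the Euclidean norm; for vectors, $|\cdot|$ and squares are componentwise. $R_\infty(z)=\liminf_{z'\to z,\ t\to+\infty}R(tz')/t$ is the asymptotic (recession) function of $R$. For a function $f$, $\ker(f)=\{z: f(z)=0\}$; $\ker(A)$ is the usual null space. No convexity of $R$ is assumed. *)

theory Defs
  imports "HOL-Analysis.Analysis"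
begin

text \<open>Functions into $\mathbb{R} \cup \{+\infty\}$ are modelled as \<^typ>\<open>ereal\<close>-valued functions;
  the value \<open>-\<infinity>\<close> is excluded by properness.\<close>

definition proper_fun :: "('a \<Rightarrow> ereal) \<Rightarrow> bool" where
  "proper_fun f \<longleftrightarrow> (\<forall>x. f x \<noteq> -\<infinity>) \<and> (\<exists>x. f x \<noteq> \<infinity>)"

definition lsc :: "('a::topological_space \<Rightarrow> ereal) \<Rightarrow> bool" where
  "lsc f \<longleftrightarrow> (\<forall>x. f x \<le> Liminf (nhds x) f)"

text \<open>The limit is the joint one in \<open>(z', t)\<close>, and, as usual in variational analysis,
  \<open>z' = z\<close> is allowed; hence \<^term>\<open>nhds z\<close> and not \<^term>\<open>at z\<close>.\<close>

definition recession_fun :: "('a::real_normed_vector \<Rightarrow> ereal) \<Rightarrow> 'a \<Rightarrow> ereal" where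
  "recession_fun f z = Liminf (nhds z \<times>\<^sub>F at_top) (\<lambda>(z', t::real). f (t *\<^sub>R z') / ereal t)"

definition ker :: "('a \<Rightarrow> 'b::zero) \<Rightarrow> 'a set" where
  "ker f = {z. f z = 0}"

definition abs_square :: "real ^ 'm \<Rightarrow> real ^ 'm" where
  "abs_square v = (\<chi> i. \<bar>v $ i\<bar>\<^sup>2)"

definition objective ::
  "real ^ 'n ^ 'm \<Rightarrow> (real ^ 'n \<Rightarrow> ereal) \<Rightarrow> real \<Rightarrow> real ^ 'm \<Rightarrow> real ^ 'n \<Rightarrow> ereal" where
  "objective A R lam y x = ereal ((norm (y - abs_square (A *v x)))\<^sup>2) + ereal lam * R x"

definition minimizers :: "('a \<Rightarrow> ereal) \<Rightarrow> 'a set" where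
  "minimizers f = {x. is_arg_min f (\<lambda>_. True) x}"

end

theory Submission
  imports Defs
begin

text \<open>The direct method. If a sublevel set of the objective contained points \<open>x\<^sub>k\<close> with
  $\|x_k\| \to \infty$, a limit point \<open>z\<close> of the directions $x_k / \|x_k\|$ would be a unit vector.
  Boundedness of \<open>R x\<^sub>k\<close> forces $R_\infty(z) = 0$, and boundedness of the quartic data term bounds
  \<open>A x\<^sub>k\<close>, so that \<open>A z = 0\<close>, contradicting the hypothesis on the kernels. Hence sublevel sets are
  compact, and the set of minimizers is a nested intersection of non-empty ones.\<close>

text \<open>The bound is a continuous function instead of a constant so that the data term of the
  objective can be moved to the right-hand side, leaving \<open>R\<close> alone on the left. A real
  number strictly between \<open>h x\<close> and \<open>f x\<close> still separates the two
  functions near \<open>x\<close>.\<close>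

lemma lsc_closed_le:
  fixes f :: "'a::topological_space \<Rightarrow> ereal" and h :: "'a \<Rightarrow> real"
  assumes "lsc f" and "continuous_on UNIV h"
  shows "closed {x. f x \<le> ereal (h x)}"
proof -
  have "open {x. ereal (h x) < f x}"
  proof (subst open_subopen, intro ballI)
    fix x assume "x \<in> {x. ereal (h x) < f x}"
    then obtain d where d: "h x < d" "ereal d < f x"
      using ereal_dense2[of "ereal (h x)" "f x"] by auto
    have "ereal d < Liminf (nhds x) f"
      using d(2) assms(1) unfolding lsc_def by (blast intro: less_le_trans)
    then have f: "eventually (\<lambda>u. ereal d < f u) (nhds x)"
      by (rule less_LiminfD)
    have "(h \<longlongrightarrow> h x) (nhds x)"
      using assms(2) by (simp add: continuous_on_def flip: tendsto_at_iff_tendsto_nhds)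
    then have "eventually (\<lambda>u. h u < d) (nhds x)"
      using d(1) by (rule order_tendstoD)
    with f have "eventually (\<lambda>u. ereal (h u) < f u) (nhds x)"
      by eventually_elim (metis less_ereal.simps(1) less_trans)
    then show "\<exists>T. open T \<and> x \<in> T \<and> T \<subseteq> {x. ereal (h x) < f x}"
      by (auto simp: eventually_nhds)
  qed
  moreover have "{x. f x \<le> ereal (h x)} = - {x. ereal (h x) < f x}"
    by auto
  ultimately show ?thesis
    by (simp add: closed_def)
qed

lemma minimizers_nonempty_compact:
  fixes f :: "'a::heine_borel \<Rightarrow> ereal"
  assumes sublevel: "\<And>c. compact {x. f x \<le> ereal c}"
    and nonneg: "\<And>x. 0 \<le> f x" and finite: "f x0 \<noteq> \<infinity>"
  shows "minimizers f \<noteq> {} \<and> compact (minimizers f)"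
proof -
  \<comment> \<open>Nonnegativity and the finite value at \<open>x0\<close> make the infimum a real
    number \<open>m\<close>, so that \<open>sublevel\<close> applies at the levels
    \<open>m + 1/(n+1)\<close> and at \<open>m\<close> itself.\<close>
  have "0 \<le> (INF x. f x)"
    using nonneg by (intro INF_greatest) auto
  moreover have "(INF x. f x) < \<infinity>"
    using finite by (meson INF_lower UNIV_I ereal_infty_less(1) le_less_trans)
  ultimately obtain m where m: "(INF x. f x) = ereal m"
    by (cases "INF x. f x") auto
  define S where "S n = {x. f x \<le> ereal (m + inverse (real (Suc n)))}" for n
  have "\<Inter>(range S) \<noteq> {}"
  proof (rule compact_nest)
    fix n
    show "compact (S n)"
      unfolding S_def by (rule sublevel)
    have "(INF x. f x) < ereal (m + inverse (real (Suc n)))"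
      by (simp add: m)
    then show "S n \<noteq> {}"
      by (auto simp: INF_less_iff S_def intro: less_imp_le)
  next
    fix k n :: nat assume "k \<le> n"
    then have "inverse (real (Suc n)) \<le> inverse (real (Suc k))"
      by (intro le_imp_inverse_le) auto
    then have "ereal (m + inverse (real (Suc n))) \<le> ereal (m + inverse (real (Suc k)))"
      by (simp only: ereal_less_eq add_le_cancel_left)
    then show "S n \<subseteq> S k"
      unfolding S_def by (blast intro: order_trans)
  qed
  then obtain x where x: "\<And>n. f x \<le> ereal (m + inverse (real (Suc n)))"
    by (auto simp: S_def)
  have "(\<lambda>n. ereal (m + inverse (real (Suc n)))) \<longlonglongrightarrow> ereal (m + 0)"
    by (intro tendsto_intros LIMSEQ_inverse_real_of_nat)
  then have "f x \<le> ereal (m + 0)"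
    by (rule LIMSEQ_le_const) (use x in blast)
  then have "f x \<le> ereal m"
    by simp
  \<comment> \<open>The minimizers form the sublevel set at level \<open>m\<close>: compact by
    \<open>sublevel\<close>, and containing the point \<open>x\<close> just found.\<close>
  moreover have "minimizers f = {x. f x \<le> ereal m}"
  proof -
    have "is_arg_min f (\<lambda>_. True) u \<longleftrightarrow> f u \<le> (INF v. f v)" for u
      by (simp add: is_arg_min_def not_less le_INF_iff)
    then show ?thesis
      by (simp add: minimizers_def m)
  qed
  ultimately show ?thesis
    using sublevel by auto
qed

lemma recession_fun_nonneg:
  assumes "\<And>x. 0 \<le> f x"
  shows "0 \<le> recession_fun f z"
  unfolding recession_fun_def
proof (rule Liminf_bounded)
  \<comment> \<open>Division by \<open>t\<close> preserves the sign only for positive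
    \<open>t\<close>, which holds eventually along \<open>at_top\<close>.\<close>
  have "eventually (\<lambda>p. 0 < snd p) (nhds z \<times>\<^sub>F (at_top :: real filter))"
    using filterlim_snd eventually_gt_at_top by (rule filterlim_iff[THEN iffD1, rule_format])
  then show "eventually (\<lambda>p. 0 \<le> (case p of (z', t) \<Rightarrow> f (t *\<^sub>R z') / ereal t))
      (nhds z \<times>\<^sub>F at_top)"
    by eventually_elim (auto simp: assms intro!: zero_le_divide_ereal)
qed

text \<open>The pairs of direction and norm of \<open>x k\<close> converge along the filter that
  defines the recession function. On them the quotient is \<open>f (x k) / norm (x k)\<close>, at
  most \<open>C / norm (x k)\<close>, which tends to 0; so no positive \<open>d\<close> can lie
  below the lower limit.\<close>

lemma recession_fun_le_zero:
  fixes f :: "'a::real_normed_vector \<Rightarrow> ereal" and x :: "nat \<Rightarrow> 'a"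
  assumes bound: "\<And>k. f (x k) \<le> ereal C"
    and norm: "filterlim (\<lambda>k. norm (x k)) at_top sequentially"
    and dir: "(\<lambda>k. x k /\<^sub>R norm (x k)) \<longlonglongrightarrow> z"
  shows "recession_fun f z \<le> 0"
proof (rule ccontr)
  assume "\<not> ?thesis"
  then obtain d where d: "0 < d" "ereal d < recession_fun f z"
    using ereal_dense2[of 0 "recession_fun f z"] by (auto simp: not_le)
  have "eventually (\<lambda>(z', t). ereal d < f (t *\<^sub>R z') / ereal t) (nhds z \<times>\<^sub>F at_top)"
    using less_LiminfD[OF d(2)[unfolded recession_fun_def]] by (simp add: case_prod_unfold)
  then have "eventually (\<lambda>k. ereal d < f (norm (x k) *\<^sub>R (x k /\<^sub>R norm (x k))) / ereal (norm (x k)))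
      sequentially"
    using filterlim_iff[THEN iffD1, rule_format, OF filterlim_Pair[OF dir norm]] by fastforce
  moreover have "eventually (\<lambda>k. 0 < norm (x k)) sequentially"
    using norm unfolding filterlim_at_top_dense by blast
  moreover have "eventually (\<lambda>k. C / norm (x k) < d) sequentially"
    using tendsto_divide_0[OF tendsto_const filterlim_at_top_imp_at_infinity[OF norm]] d(1)
    by (rule order_tendstoD)
  ultimately have "eventually (\<lambda>k::nat. False) sequentially"
  proof eventually_elim
    case (elim k)
    then have "f (x k) / ereal (norm (x k)) \<le> ereal C / ereal (norm (x k))"
      using bound by (intro ereal_divide_right_mono) auto
    also have "\<dots> = ereal (C / norm (x k))"
      using elim by simp
    also have "\<dots> < ereal d"
      using elim by simp
    finally show False
      using elim by simp
  qed
  then show False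
    by simp
qed

text \<open>Cauchy-Schwarz against the all-ones vector \<open>1\<close>. This turns a bound on the
  data term into a bound on \<open>A *v x\<close>.\<close>

lemma norm_power2_le_abs_square:
  fixes v :: "real ^ 'm"
  shows "(norm v)\<^sup>2 \<le> norm (abs_square v) * norm (1 :: real ^ 'm)"
proof -
  have "(norm v)\<^sup>2 = abs_square v \<bullet> 1"
    by (simp add: power2_norm_eq_inner inner_vec_def abs_square_def flip: power2_eq_square)
  then show ?thesis
    using norm_cauchy_schwarz[of "abs_square v" 1] by simp
qed

lemma objective_le_iff:
  assumes "0 < lam" and "0 \<le> R x"
  shows "objective A R lam y x \<le> ereal c \<longleftrightarrow>
    R x \<le> ereal ((c - (norm (y - abs_square (A *v x)))\<^sup>2) / lam)"
  using assms by (cases "R x") (auto simp: objective_def field_simps)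

lemma bounded_sublevel_objective:
  fixes A :: "real ^ 'n ^ 'm" and R :: "real ^ 'n \<Rightarrow> ereal"
  assumes nonneg: "\<And>x. 0 \<le> R x"
    and kernels: "ker (recession_fun R) \<inter> ker ((*v) A) = {0}"
    and lam: "0 < lam"
  shows "bounded {x. objective A R lam y x \<le> ereal c}"
proof (rule ccontr)
  let ?g = "\<lambda>x. (norm (y - abs_square (A *v x)))\<^sup>2"
  assume "\<not> ?thesis"
  then have "\<forall>k::nat. \<exists>x. objective A R lam y x \<le> ereal c \<and> real k < norm x"
    by (fastforce simp: bounded_iff not_le)
  then obtain x where obj: "\<And>k. objective A R lam y (x k) \<le> ereal c"
    and large: "\<And>k::nat. real k < norm (x k)"
    by metis
  have R_le: "R (x k) \<le> ereal ((c - ?g (x k)) / lam)" for k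
    using obj lam nonneg by (simp add: objective_le_iff)
  \<comment> \<open>Since \<open>R\<close> is nonnegative, so is the right-hand side of
    \<open>R_le\<close>.\<close>
  have g_le: "?g (x k) \<le> c" for k
  proof -
    have "ereal 0 \<le> ereal ((c - ?g (x k)) / lam)"
      using order_trans[OF nonneg R_le] by (simp add: zero_ereal_def)
    then show ?thesis
      using lam by (simp add: zero_le_divide_iff)
  qed
  have R_bound: "R (x k) \<le> ereal (c / lam)" for k
    using R_le by (rule order_trans) (use lam in \<open>simp add: divide_right_mono\<close>)
  \<comment> \<open>The residual has norm at most \<open>sqrt c\<close>, so the triangle inequality
    bounds \<open>abs_square (A *v x k)\<close> by \<open>norm y + sqrt c\<close>; the other factor
    comes from \<open>norm_power2_le_abs_square\<close>.\<close>
  define B where "B = sqrt ((norm y + sqrt c) * norm (1 :: real ^ 'm))"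
  have A_bound: "norm (A *v x k) \<le> B" for k
  proof -
    have "norm (y - abs_square (A *v x k)) \<le> sqrt c"
      using g_le by (rule real_le_rsqrt)
    then have "norm (abs_square (A *v x k)) \<le> norm y + sqrt c"
      using norm_triangle_ineq2[of "abs_square (A *v x k)" y] by (simp add: norm_minus_commute)
    then have "(norm (A *v x k))\<^sup>2 \<le> (norm y + sqrt c) * norm (1 :: real ^ 'm)"
      by (meson norm_power2_le_abs_square mult_right_mono norm_ge_zero order_trans)
    then show ?thesis
      unfolding B_def by (rule real_le_rsqrt)
  qed
  \<comment> \<open>The strict inequality in \<open>large\<close> makes \<open>x k\<close> nonzero
    even for \<open>k = 0\<close>.\<close>
  have "x k /\<^sub>R norm (x k) \<in> sphere 0 1" for k
    using le_less_trans[OF of_nat_0_le_iff large[of k]] by simp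
  then obtain z r where z: "z \<in> sphere 0 1" and r: "strict_mono (r :: nat \<Rightarrow> nat)"
    and dir: "(\<lambda>k. x (r k) /\<^sub>R norm (x (r k))) \<longlonglongrightarrow> z"
    using compact_sphere[of "0 :: real ^ 'n" 1, unfolded compact_def, rule_format,
      of "\<lambda>k. x k /\<^sub>R norm (x k)"] by (auto simp: o_def)
  have "filterlim (\<lambda>k. norm (x k)) at_top sequentially"
    using less_imp_le[OF large]
    by (intro filterlim_at_top_mono[OF filterlim_real_sequentially] always_eventually) blast
  then have norm: "filterlim (\<lambda>k. norm (x (r k))) at_top sequentially"
    using filterlim_subseq[OF r] by (rule filterlim_compose)
  have "recession_fun R z = 0"
    using recession_fun_le_zero[of R "\<lambda>k. x (r k)", OF R_bound norm dir]
      recession_fun_nonneg[of R, OF nonneg] by (rule antisym)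
  \<comment> \<open>The images of the normalized points tend to \<open>A *v z\<close> by continuity,
    and to 0 because their norms are at most \<open>B / norm (x (r k))\<close>.\<close>
  moreover have "A *v z = 0"
  proof (rule LIMSEQ_unique)
    show "(\<lambda>k. A *v (x (r k) /\<^sub>R norm (x (r k)))) \<longlonglongrightarrow> A *v z"
      using dir by (rule bounded_linear.tendsto[OF matrix_vector_mul_bounded_linear])
    have "(\<lambda>k. B / norm (x (r k))) \<longlonglongrightarrow> 0"
      by (rule tendsto_divide_0[OF tendsto_const filterlim_at_top_imp_at_infinity[OF norm]])
    then show "(\<lambda>k. A *v (x (r k) /\<^sub>R norm (x (r k)))) \<longlonglongrightarrow> 0"
      by (rule Lim_null_comparison[rotated], intro always_eventually allI)
        (simp add: matrix_vector_mult_scaleR divide_inverse_commute mult_left_mono A_bound)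
  qed
  ultimately have "z = 0"
    using kernels unfolding ker_def by blast
  with z show False
    by simp
qed

theorem proposition5p1:
  fixes A :: "real ^ 'n ^ 'm" and R :: "real ^ 'n \<Rightarrow> ereal"
  assumes "proper_fun R"
    and "lsc R"
    and "\<And>x. 0 \<le> R x"
    and "ker (recession_fun R) \<inter> ker ((*v) A) = {0}"
  shows "\<forall>lam>0. \<forall>y :: real ^ 'm.
    minimizers (objective A R lam y) \<noteq> {} \<and> compact (minimizers (objective A R lam y))"
proof (intro allI impI)
  fix lam :: real and y :: "real ^ 'm"
  assume lam: "0 < lam"
  obtain x0 where x0: "R x0 \<noteq> \<infinity>"
    using assms(1) by (auto simp: proper_fun_def)
  show "minimizers (objective A R lam y) \<noteq> {} \<and> compact (minimizers (objective A R lam y))"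
  proof (rule minimizers_nonempty_compact)
    fix c
    \<comment> \<open>This function is the bound on \<open>R x\<close> in
      \<open>objective_le_iff\<close>, which puts the sublevel set into the form handled by
      \<open>lsc_closed_le\<close>.\<close>
    have "continuous_on UNIV (\<lambda>x. (c - (norm (y - abs_square (A *v x)))\<^sup>2) / lam)"
      unfolding abs_square_def using lam
      by (intro continuous_intros matrix_vector_mult_linear_continuous_on) auto
    then have "closed {x. objective A R lam y x \<le> ereal c}"
      using lsc_closed_le[OF assms(2)] by (simp add: objective_le_iff lam assms(3))
    then show "compact {x. objective A R lam y x \<le> ereal c}"
      using bounded_sublevel_objective[OF assms(3,4) lam] by (simp add: compact_eq_bounded_closed)
  next
    show "0 \<le> objective A R lam y x" for x
      using lam assms(3) by (simp add: objective_def)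
    show "objective A R lam y x0 \<noteq> \<infinity>"
      using x0 lam assms(3)[of x0] by (cases "R x0") (auto simp: objective_def)
  qed
qed

end
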